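(* Let $a,b$ be non-zero integers, $n$ a positive integer, $\overline{X}=(x_1,\ldots,x_n)$, and let $f_1,f_2$ be homogeneous forms in $\overline{X}$ with integer coefficients such that $\deg f_2=2\deg f_1+1$. Then the set of rational points on the hypersurface $\mathcal{W}:\;a(y_1^4-f_1(\overline{X})^4)=b(y_2^4-f_2(\overline{X})^2)$ is dense in the Zariski topology. Moreover, there are infinitely many rational curves lying on $\mathcal{W}$. *)

theory Defs
  imports
    "HOL-Analysis.Analysis"
    "HOL-Library.Poly_Mapping"
    "HOL-Computational_Algebra.Polynomial"
begin

text \<open>Polynomials over \<open>'k\<close> in variables indexed by \<open>'v\<close>: finitely supported
  coefficient functions on monomials, a monomial being a finitely supported exponent vector.\<close>

type_synonym ('v, 'k) mpoly = "('v \<Rightarrow>\<^sub>0 nat) \<Rightarrow>\<^sub>0 'k"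

definition monomial_degree :: "('v \<Rightarrow>\<^sub>0 nat) \<Rightarrow> nat" where
  "monomial_degree m = (\<Sum>v\<in>Poly_Mapping.keys m. Poly_Mapping.lookup m v)"

definition total_degree :: "('v, 'k::zero) mpoly \<Rightarrow> nat" where
  "total_degree f = Max (insert 0 (monomial_degree ` Poly_Mapping.keys f))"

definition homogeneous :: "('v, 'k::zero) mpoly \<Rightarrow> bool" where
  "homogeneous f \<longleftrightarrow> (\<exists>d. \<forall>m\<in>Poly_Mapping.keys f. monomial_degree m = d)"

definition monomial_eval :: "('v \<Rightarrow> 'r) \<Rightarrow> ('v \<Rightarrow>\<^sub>0 nat) \<Rightarrow> 'r::comm_ring_1" where
  "monomial_eval x m = (\<Prod>v\<in>Poly_Mapping.keys m. x v ^ Poly_Mapping.lookup m v)"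

text \<open>The argument \<open>h\<close> is the homomorphism carrying the coefficients into the ring in which
  the polynomial is evaluated.\<close>

definition mpoly_eval :: "('k \<Rightarrow> 'r) \<Rightarrow> ('v \<Rightarrow> 'r) \<Rightarrow> ('v, 'k::zero) mpoly \<Rightarrow> 'r::comm_ring_1" where
  "mpoly_eval h x p = (\<Sum>m\<in>Poly_Mapping.keys p. h (Poly_Mapping.lookup p m) * monomial_eval x m)"

lemma monomial_eval_superset:
  assumes "finite A" "Poly_Mapping.keys m \<subseteq> A"
  shows "monomial_eval x m = (\<Prod>v\<in>A. x v ^ Poly_Mapping.lookup m v)"
  unfolding monomial_eval_def
  by (rule prod.mono_neutral_left) (use assms in \<open>auto simp: in_keys_iff\<close>)

lemma monomial_eval_add: "monomial_eval x (k + l) = monomial_eval x k * monomial_eval x l"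
proof -
  let ?A = "Poly_Mapping.keys k \<union> Poly_Mapping.keys l"
  have "monomial_eval x (k + l) = (\<Prod>v\<in>?A. x v ^ Poly_Mapping.lookup (k + l) v)"
    by (rule monomial_eval_superset) (auto simp: in_keys_iff lookup_add)
  also have "\<dots> = (\<Prod>v\<in>?A. x v ^ Poly_Mapping.lookup k v) * (\<Prod>v\<in>?A. x v ^ Poly_Mapping.lookup l v)"
    by (simp add: lookup_add power_add prod.distrib)
  also have "\<dots> = monomial_eval x k * monomial_eval x l"
    by (simp add: monomial_eval_superset[of ?A])
  finally show ?thesis .
qed

lemma mpoly_eval_superset:
  assumes "finite A" "Poly_Mapping.keys p \<subseteq> A" "h 0 = 0"
  shows "mpoly_eval h x p = (\<Sum>m\<in>A. h (Poly_Mapping.lookup p m) * monomial_eval x m)"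
  unfolding mpoly_eval_def
  by (rule sum.mono_neutral_left) (use assms in \<open>auto simp: in_keys_iff\<close>)

lemma mpoly_eval_0 [simp]: "mpoly_eval h x 0 = 0"
  by (simp add: mpoly_eval_def)

lemma mpoly_eval_1 [simp]: "mpoly_eval (\<lambda>c. c) x (1 :: ('v, 'k::comm_ring_1) mpoly) = 1"
  by (simp add: mpoly_eval_def monomial_eval_def lookup_one)

lemma mpoly_eval_single:
  "h 0 = 0 \<Longrightarrow> mpoly_eval h x (Poly_Mapping.single m c) = h c * monomial_eval x m"
  by (simp add: mpoly_eval_def)

lemma mpoly_eval_add:
  fixes p q :: "('v, 'k::comm_ring_1) mpoly"
  shows "mpoly_eval (\<lambda>c. c) x (p + q) = mpoly_eval (\<lambda>c. c) x p + mpoly_eval (\<lambda>c. c) x q"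
proof -
  let ?A = "Poly_Mapping.keys p \<union> Poly_Mapping.keys q"
  have "mpoly_eval (\<lambda>c. c) x (p + q) = (\<Sum>m\<in>?A. Poly_Mapping.lookup (p + q) m * monomial_eval x m)"
    by (subst mpoly_eval_superset[of ?A]) (auto simp: in_keys_iff lookup_add)
  also have "\<dots> = (\<Sum>m\<in>?A. Poly_Mapping.lookup p m * monomial_eval x m) + (\<Sum>m\<in>?A. Poly_Mapping.lookup q m * monomial_eval x m)"
    by (simp add: lookup_add distrib_right sum.distrib)
  also have "\<dots> = mpoly_eval (\<lambda>c. c) x p + mpoly_eval (\<lambda>c. c) x q"
    by (simp add: mpoly_eval_superset[of ?A])
  finally show ?thesis .
qed

lemma update_eq_add_single:
  fixes p :: "('v, 'k::comm_ring_1) mpoly"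
  assumes "k \<notin> Poly_Mapping.keys p"
  shows "Poly_Mapping.update k c p = p + Poly_Mapping.single k c"
  using assms
  by (intro poly_mapping_eqI) (auto simp: lookup_update lookup_add lookup_single in_keys_iff when_def
     )

lemma mpoly_eval_mult:
  fixes p q :: "('v, 'k::comm_ring_1) mpoly"
  shows "mpoly_eval (\<lambda>c. c) x (p * q) = mpoly_eval (\<lambda>c. c) x p * mpoly_eval (\<lambda>c. c) x q"
proof -
  have single: "mpoly_eval (\<lambda>c. c) x (Poly_Mapping.single k c * q)
      = c * monomial_eval x k * mpoly_eval (\<lambda>c. c) x q" for k c
  proof (induction q rule: update_induct)
    case const
    then show ?case by simp
  next
    case (update q l d)
    then show ?case
      by (simp add: update_eq_add_single distrib_left mpoly_eval_add mult_single
          mpoly_eval_single monomial_eval_add)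
  qed
  show ?thesis
  proof (induction p rule: update_induct)
    case const
    then show ?case by simp
  next
    case (update p l d)
    then show ?case
      by (simp add: update_eq_add_single distrib_right mpoly_eval_add single mpoly_eval_single)
  qed
qed

definition zero_set :: "('v::finite, complex) mpoly set \<Rightarrow> ('v \<Rightarrow> complex) set" where
  "zero_set P = {x. \<forall>p\<in>P. mpoly_eval (\<lambda>c. c) x p = 0}"

definition zariski :: "('v::finite \<Rightarrow> complex) topology" where
  "zariski = topology (\<lambda>U. \<exists>P. - U = zero_set P)"

lemma istopology_zariski:
  "istopology (\<lambda>U :: ('v::finite \<Rightarrow> complex) set. \<exists>P. - U = zero_set P)"
  unfolding istopology_def
proof (intro conjI allI impI)
  fix S T :: "('v \<Rightarrow> complex) set"
  assume "\<exists>P. - S = zero_set P" "\<exists>P. - T = zero_set P"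
  then obtain P Q where P: "- S = zero_set P" and Q: "- T = zero_set Q" by blast
  have "- (S \<inter> T) = zero_set P \<union> zero_set Q"
    using P Q by blast
  also have "\<dots> = zero_set ((\<lambda>(p, q). p * q) ` (P \<times> Q))"
    by (auto simp: zero_set_def mpoly_eval_mult)
  finally show "\<exists>P. - (S \<inter> T) = zero_set P" by blast
next
  fix \<K> :: "('v \<Rightarrow> complex) set set"
  assume "\<forall>K\<in>\<K>. \<exists>P. - K = zero_set P"
  then obtain P where P: "\<And>K. K \<in> \<K> \<Longrightarrow> - K = zero_set (P K)" by metis
  have "- \<Union>\<K> = (\<Inter>K\<in>\<K>. - K)" by blast
  also have "\<dots> = (\<Inter>K\<in>\<K>. zero_set (P K))" using P by simp
  also have "\<dots> = zero_set (\<Union>K\<in>\<K>. P K)" by (auto simp: zero_set_def)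
  finally show "\<exists>P. - \<Union>\<K> = zero_set P" by blast
qed

lemma openin_zariski: "openin zariski U \<longleftrightarrow> (\<exists>P. - U = zero_set P)"
  by (simp add: zariski_def istopology_zariski)

lemma topspace_zariski [simp]: "topspace zariski = UNIV"
proof -
  have "- UNIV = zero_set {1}" by (simp add: zero_set_def)
  then have "openin zariski UNIV" using openin_zariski by blast
  then show ?thesis using openin_subset by blast
qed

lemma closedin_zariski: "closedin zariski S \<longleftrightarrow> (\<exists>P. S = zero_set P)"
  unfolding closedin_def openin_zariski topspace_zariski
  by (metis Compl_eq_Diff_UNIV double_complement subset_UNIV)

definition rational_points :: "('v \<Rightarrow> complex) set \<Rightarrow> ('v \<Rightarrow> complex) set" where
  "rational_points S = {x \<in> S. \<forall>v. x v \<in> \<rat>}"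

text \<open>A rational curve (over \<open>\<rat>\<close>) is the Zariski closure of the image of a non-constant tuple of
  rational functions \<open>num v / den v\<close> of one parameter, with rational coefficients. The condition
  on \<open>c\<close> says that some \<open>num v / den v\<close> is not constant.\<close>

definition rational_curve :: "('v::finite \<Rightarrow> complex) set \<Rightarrow> bool" where
  "rational_curve C \<longleftrightarrow>
    (\<exists>num den :: 'v \<Rightarrow> rat poly.
      (\<forall>v. den v \<noteq> 0) \<and>
      (\<exists>v. \<forall>c. num v \<noteq> smult c (den v)) \<and>
      C = zariski closure_of
        {(\<lambda>v. poly (map_poly of_rat (num v)) t / poly (map_poly of_rat (den v)) t) | t.
          \<forall>v. poly (map_poly of_rat (den v)) t \<noteq> 0})"

datatype 'n coord = X 'n | Y1 | Y2

instance coord :: (finite) finite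
proof
  have "c \<in> range X \<union> {Y1, Y2}" for c :: "'a coord"
    by (cases c) simp_all
  then have "UNIV \<subseteq> range X \<union> {Y1, Y2 :: 'a coord}"
    by (rule subsetI)
  then show "finite (UNIV :: 'a coord set)"
    by (rule finite_subset) simp
qed

text \<open>The complex points of \<open>\<W>\<close>, in affine space of dimension \<open>n + 2\<close> with \<open>n = CARD('n)\<close>.\<close>

definition hypersurface_W ::
  "int \<Rightarrow> int \<Rightarrow> ('n::finite, int) mpoly \<Rightarrow> ('n, int) mpoly \<Rightarrow> ('n coord \<Rightarrow> complex) set" where
  "hypersurface_W a b f1 f2 =
    {p. of_int a * (p Y1 ^ 4 - mpoly_eval of_int (\<lambda>i. p (X i)) f1 ^ 4)
      = of_int b * (p Y2 ^ 4 - mpoly_eval of_int (\<lambda>i. p (X i)) f2 ^ 2)}"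

end

theory Submission
  imports Defs
begin

text \<open>Put \<open>k = a / b\<close> and \<open>d = deg f\<^sub>1\<close>. Along the ray \<open>t x\<close>, with \<open>y\<^sub>1 = t\<^sup>d f\<^sub>1(x) p\<close>,
  \<open>y\<^sub>2 = t\<^sup>d f\<^sub>1(x) q\<close> and \<open>t f\<^sub>2(x) = f\<^sub>1(x)\<^sup>2 w\<close>, the powers of \<open>t\<close> cancel by the condition on the degrees
  and the equation of \<open>\<W>\<close> becomes \<open>w\<^sup>2 - q\<^sup>4 = k (1 - p\<^sup>4)\<close>. This surface carries the conic bundle
  \<open>w - q\<^sup>2 = \<lambda> (1 - p\<^sup>2)\<close>, \<open>\<lambda> (w + q\<^sup>2) = k (1 + p\<^sup>2)\<close>, and for \<open>\<lambda> = k s\<^sup>2\<close> the conic has the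
  rational point \<open>(p, q) = (1, 1/s)\<close>. Projecting from that point with slope \<open>m\<close> gives a map from
  \<open>(x, s, m)\<close>-space to \<open>\<W>\<close>, defined over the rationals, whose image contains all sufficiently general
  points. A polynomial vanishing at the rational points of \<open>\<W>\<close> pulls back to zero, hence vanishes at
  the general points, and by continuity on all of \<open>\<W>\<close>. With \<open>x\<close> and \<open>s\<close> fixed, \<open>m\<close> parametrizes a
  rational curve; \<open>s\<^sup>2\<close> can be recovered from the curve through the conic bundle.\<close>

section \<open>Polynomial functions and Zariski closed sets\<close>

text \<open>Polynomials are treated as functions, so that substitution and limits go by rule
  induction. Coefficients return only in \<open>polyfun_imp_mpoly\<close>, to reach
  \<open>zero_set\<close>.\<close>

inductive polyfun :: "(('v \<Rightarrow> complex) \<Rightarrow> complex) \<Rightarrow> bool" where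
  const: "polyfun (\<lambda>x. c)"
| coord: "polyfun (\<lambda>x. x v)"
| add: "polyfun f \<Longrightarrow> polyfun g \<Longrightarrow> polyfun (\<lambda>x. f x + g x)"
| mult: "polyfun f \<Longrightarrow> polyfun g \<Longrightarrow> polyfun (\<lambda>x. f x * g x)"

lemma polyfun_diff: "polyfun f \<Longrightarrow> polyfun g \<Longrightarrow> polyfun (\<lambda>x. f x - g x)"
  using polyfun.add[OF _ polyfun.mult[OF polyfun.const[of "-1"]], of f g] by simp

lemma polyfun_power: "polyfun f \<Longrightarrow> polyfun (\<lambda>x. f x ^ n)"
  by (induction n) (auto intro: polyfun.intros)

lemma polyfun_sum: "(\<And>i. i \<in> A \<Longrightarrow> polyfun (f i)) \<Longrightarrow> polyfun (\<lambda>x. \<Sum>i\<in>A. f i x)"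
  by (induction A rule: infinite_finite_induct) (auto intro: polyfun.intros)

lemma polyfun_prod: "(\<And>i. i \<in> A \<Longrightarrow> polyfun (f i)) \<Longrightarrow> polyfun (\<lambda>x. \<Prod>i\<in>A. f i x)"
  by (induction A rule: infinite_finite_induct) (auto intro: polyfun.intros)

lemma polyfun_mpoly_eval:
  "(\<And>v. polyfun (g v)) \<Longrightarrow> polyfun (\<lambda>x. mpoly_eval h (\<lambda>v. g v x) p)"
  unfolding mpoly_eval_def monomial_eval_def
  by (intro polyfun_sum polyfun.mult polyfun.const polyfun_prod polyfun_power)

lemmas polyfun_intros = polyfun.intros polyfun_diff polyfun_power polyfun_mpoly_eval

lemma polyfun_imp_mpoly:
  "polyfun f \<Longrightarrow> \<exists>p. \<forall>x. f x = mpoly_eval (\<lambda>c. c) x p"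
proof (induction rule: polyfun.induct)
  case (const c)
  have "\<forall>x :: 'a \<Rightarrow> complex. c = mpoly_eval (\<lambda>c. c) x (Poly_Mapping.single 0 c)"
    by (simp add: mpoly_eval_single monomial_eval_def)
  then show ?case by blast
next
  case (coord v)
  have "\<forall>x :: 'a \<Rightarrow> complex.
      x v = mpoly_eval (\<lambda>c. c) x (Poly_Mapping.single (Poly_Mapping.single v 1) 1)"
    by (simp add: mpoly_eval_single monomial_eval_def)
  then show ?case by blast
next
  case (add f g)
  then show ?case by (metis mpoly_eval_add)
next
  case (mult f g)
  then show ?case by (metis mpoly_eval_mult)
qed

lemma closedin_zariski_polyfun:
  assumes "polyfun f"
  shows "closedin zariski {x. f x = 0}"
proof -
  from polyfun_imp_mpoly[OF assms] obtain p where "\<forall>x. f x = mpoly_eval (\<lambda>c. c) x p" by blast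
  then have "{x. f x = 0} = zero_set {p}" by (simp add: zero_set_def)
  then show ?thesis using closedin_zariski by blast
qed

text \<open>The closure is the common zero set of some polynomials, and each of these vanishes on
  \<open>S\<close>.\<close>

lemma zariski_closure_ofI:
  assumes "\<And>f. polyfun f \<Longrightarrow> (\<And>y. y \<in> S \<Longrightarrow> f y = 0) \<Longrightarrow> f x = 0"
  shows "x \<in> zariski closure_of S"
proof -
  have "closedin zariski (zariski closure_of S)" by simp
  then obtain P where P: "zariski closure_of S = zero_set P"
    using closedin_zariski by blast
  have sub: "S \<subseteq> zariski closure_of S" by (simp add: closure_of_subset)
  have "mpoly_eval (\<lambda>c. c) x p = 0" if "p \<in> P" for p
  proof (rule assms)
    show "polyfun (\<lambda>x. mpoly_eval (\<lambda>c. c) x p)"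
      by (intro polyfun_intros)
    show "mpoly_eval (\<lambda>c. c) y p = 0" if "y \<in> S" for y
      using that sub P \<open>p \<in> P\<close> by (auto simp: zero_set_def)
  qed
  then show ?thesis by (simp add: P zero_set_def)
qed

section \<open>Restriction to lines, limits, and vanishing on rational points\<close>

lemma polyfun_poly_compose:
  "polyfun f \<Longrightarrow> \<exists>p. \<forall>t. f (\<lambda>v. poly (g v) t) = poly p t"
proof (induction rule: polyfun.induct)
  case (const c)
  then show ?case by (intro exI[of _ "[:c:]"]) simp
next
  case (coord v)
  then show ?case by blast
next
  case (add f g)
  then show ?case by (metis poly_add)
next
  case (mult f g)
  then show ?case by (metis poly_mult)
qed

lemma polyfun_line:
  assumes "polyfun f"
  obtains p where "\<And>t. f (\<lambda>v. x v + t * (y v - x v)) = poly p t"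
  using polyfun_poly_compose[OF assms, of "\<lambda>v. [:x v, y v - x v:]"] that by auto

lemma polyfun_tendsto:
  "polyfun f \<Longrightarrow> (\<And>v. ((\<lambda>t. y t v) \<longlongrightarrow> z v) A) \<Longrightarrow> ((\<lambda>t. f (y t)) \<longlongrightarrow> f z) A"
  by (induction rule: polyfun.induct) (auto intro!: tendsto_intros)

text \<open>Coordinates are freed from rationality one at a time: in a single coordinate, a
  polynomial with all rationals as roots is zero.\<close>

lemma polyfun_eq_0_if_rational:
  fixes f :: "('v::finite \<Rightarrow> complex) \<Rightarrow> complex"
  assumes f: "polyfun f" and rat: "\<And>x. (\<And>v. x v \<in> \<rat>) \<Longrightarrow> f x = 0"
  shows "f x = 0"
proof -
  \<comment> \<open>\<open>S\<close> is the set of coordinates already allowed to be arbitrary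
    complex numbers.\<close>
  have "\<forall>x. (\<forall>v. v \<notin> S \<longrightarrow> x v \<in> \<rat>) \<longrightarrow> f x = 0" for S
  proof (induction S rule: finite_induct[OF finite])
    case 1
    then show ?case using rat by simp
  next
    case (2 u S)
    show ?case
    proof (intro allI impI)
      fix x :: "'v \<Rightarrow> complex" assume x: "\<forall>v. v \<notin> insert u S \<longrightarrow> x v \<in> \<rat>"
      obtain p where p: "\<And>t. f (\<lambda>v. poly (if v = u then [:0, 1:] else [:x v:]) t) = poly p t"
        using polyfun_poly_compose[OF f] by metis
      have "\<rat> \<subseteq> {t. poly p t = 0}"
        using 2(3) x by (auto simp flip: p)
      moreover have "infinite (\<rat> :: complex set)"
        by (meson Nats_infinite Nats_subset_Rats infinite_super)
      ultimately have "p = 0"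
        using poly_roots_finite infinite_super by blast
      moreover have "x = (\<lambda>v. poly (if v = u then [:0, 1:] else [:x v:]) (x u))" by auto
      ultimately show "f x = 0" using p[of "x u"] by simp
    qed
  qed
  from this[of UNIV] show ?thesis by simp
qed

lemma poly_nonzero_point:
  fixes p :: "complex poly"
  assumes "p \<noteq> 0"
  obtains t where "poly p t \<noteq> 0"
  using assms poly_all_0_iff_0 by blast

text \<open>On the line through \<open>x\<close> and \<open>y\<close> both functions become nonzero
  univariate polynomials, whose product is nonzero somewhere.\<close>

lemma polyfun_nonzero_mult:
  assumes f: "polyfun f" "f x \<noteq> 0" and g: "polyfun g" "g y \<noteq> 0"
  obtains z where "f z \<noteq> 0" "g z \<noteq> 0"
proof -
  obtain p where p: "\<And>t. f (\<lambda>v. x v + t * (y v - x v)) = poly p t" by (rule polyfun_line[OF f(1), of x y]) blast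
  obtain q where q: "\<And>t. g (\<lambda>v. x v + t * (y v - x v)) = poly q t" by (rule polyfun_line[OF g(1), of x y]) blast
  have "p \<noteq> 0" "q \<noteq> 0" using p[of 0] q[of 1] f g by auto
  then obtain t where "poly (p * q) t \<noteq> 0"
    by (metis mult_eq_0_iff poly_nonzero_point)
  then show ?thesis using that[of "\<lambda>v. x v + t * (y v - x v)"] p[of t] q[of t] by auto
qed

section \<open>Regular functions off a hypersurface\<close>

text \<open>Regular functions on the complement of the zero set of \<open>h\<close>; the values where \<open>h\<close> vanishes
  are irrelevant.\<close>

definition regular_off :: "(('v \<Rightarrow> complex) \<Rightarrow> complex) \<Rightarrow> (('v \<Rightarrow> complex) \<Rightarrow> complex) \<Rightarrow> bool" where
  "regular_off h f \<longleftrightarrow> (\<exists>R n. polyfun R \<and> (\<forall>x. h x \<noteq> 0 \<longrightarrow> h x ^ n * f x = R x))"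

lemma regular_off_polyfun: "polyfun f \<Longrightarrow> regular_off h f"
  unfolding regular_off_def by (rule exI[of _ f], rule exI[of _ 0]) simp

lemma regular_off_divide:
  assumes "polyfun f" "polyfun g" "\<And>x. h x = g x * e x"  "polyfun e"
  shows "regular_off h (\<lambda>x. f x / g x)"
  unfolding regular_off_def
  by (rule exI[of _ "\<lambda>x. e x * f x"], rule exI[of _ 1])
    (use assms in \<open>auto intro: polyfun_intros\<close>)

lemma regular_off_mult:
  assumes "regular_off h f" "regular_off h g"
  shows "regular_off h (\<lambda>x. f x * g x)"
proof -
  obtain R m S n where RS: "polyfun R" "polyfun S"
    "\<And>x. h x \<noteq> 0 \<Longrightarrow> h x ^ m * f x = R x" "\<And>x. h x \<noteq> 0 \<Longrightarrow> h x ^ n * g x = S x"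
    using assms unfolding regular_off_def by metis
  have "h x ^ (m + n) * (f x * g x) = R x * S x" if "h x \<noteq> 0" for x
    by (simp add: RS(3,4)[OF that, symmetric] power_add algebra_simps)
  moreover have "polyfun (\<lambda>x. R x * S x)" using RS by (intro polyfun_intros)
  ultimately show ?thesis unfolding regular_off_def by blast
qed

lemma regular_off_add:
  assumes "polyfun h" "regular_off h f" "regular_off h g"
  shows "regular_off h (\<lambda>x. f x + g x)"
proof -
  obtain R m S n where RS: "polyfun R" "polyfun S"
    "\<And>x. h x \<noteq> 0 \<Longrightarrow> h x ^ m * f x = R x" "\<And>x. h x \<noteq> 0 \<Longrightarrow> h x ^ n * g x = S x"
    using assms unfolding regular_off_def by metis
  have "h x ^ (m + n) * (f x + g x) = h x ^ n * R x + h x ^ m * S x" if "h x \<noteq> 0" for x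
    by (simp add: RS(3,4)[OF that, symmetric] power_add algebra_simps)
  moreover have "polyfun (\<lambda>x. h x ^ n * R x + h x ^ m * S x)"
    using RS assms by (intro polyfun_intros)
  ultimately show ?thesis unfolding regular_off_def by blast
qed

lemma regular_off_power: "regular_off h f \<Longrightarrow> regular_off h (\<lambda>x. f x ^ n)"
  by (induction n) (auto intro: regular_off_polyfun regular_off_mult polyfun.const)

lemma regular_off_compose:
  "polyfun f \<Longrightarrow> polyfun h \<Longrightarrow> (\<And>v. regular_off h (\<lambda>x. g x v)) \<Longrightarrow> regular_off h (\<lambda>x. f (g x))"
  by (induction rule: polyfun.induct)
    (auto intro: regular_off_polyfun regular_off_mult regular_off_add polyfun.const)

lemma regular_off_eq_0_if_rational:
  fixes f :: "('v::finite \<Rightarrow> complex) \<Rightarrow> complex"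
  assumes "polyfun h" "regular_off h f"
    and rat: "\<And>x. (\<And>v. x v \<in> \<rat>) \<Longrightarrow> h x \<noteq> 0 \<Longrightarrow> f x = 0" and "h x \<noteq> 0"
  shows "f x = 0"
proof -
  obtain R n where R: "polyfun R" "\<And>x. h x \<noteq> 0 \<Longrightarrow> h x ^ n * f x = R x"
    using assms(2) unfolding regular_off_def by blast
  \<comment> \<open>The extra factor \<open>h x\<close> covers the rational points where
    \<open>h\<close> vanishes and \<open>rat\<close> says nothing.\<close>
  have "h x * R x = 0"
  proof (rule polyfun_eq_0_if_rational[where x = x])
    show "polyfun (\<lambda>x. h x * R x)" using assms R by (intro polyfun_intros)
    show "h y * R y = 0" if "\<And>v. y v \<in> \<rat>" for y
      using rat[OF that] R(2)[of y] by fastforce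
  qed
  then show ?thesis using R(2)[of x] assms(4) by simp
qed

section \<open>Nonvanishing of formal polynomials at integer points\<close>

text \<open>A Vandermonde argument: by linearity the powers may be replaced by any polynomial in
  \<open>w i\<close>, in particular by one vanishing at every \<open>w i\<close> except
  \<open>w j\<close>.\<close>

lemma sum_powers_eq_0_imp_coeff_0:
  fixes w :: "'i \<Rightarrow> 'k::idom"
  assumes "finite A" "inj_on w A" "\<And>n. (\<Sum>i\<in>A. c i * w i ^ n) = 0" "j \<in> A"
  shows "c j = 0"
proof -
  have vanish: "(\<Sum>i\<in>A. c i * poly q (w i)) = 0" for q
  proof -
    have "(\<Sum>i\<in>A. c i * poly q (w i)) = (\<Sum>i\<in>A. \<Sum>n\<le>degree q. coeff q n * (c i * w i ^ n))"
      by (simp add: poly_altdef sum_distrib_left mult_ac)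
    also have "\<dots> = (\<Sum>n\<le>degree q. coeff q n * (\<Sum>i\<in>A. c i * w i ^ n))"
      by (subst sum.swap) (simp add: sum_distrib_left)
    finally show ?thesis by (simp add: assms(3))
  qed
  define q where "q = (\<Prod>i\<in>A - {j}. [:- w i, 1:])"
  have q: "poly q x = (\<Prod>i\<in>A - {j}. x - w i)" for x
    by (simp add: q_def poly_prod)
  have "0 = (\<Sum>i\<in>A. c i * poly q (w i))" using vanish by simp
  also have "\<dots> = c j * poly q (w j)"
    using assms(1,4) by (subst sum.remove[of _ j]) (auto simp: q intro!: sum.neutral)
  finally show ?thesis
    using assms(1,2,4) by (auto simp: q inj_on_def)
qed

text \<open>At the points whose coordinates are the \<open>j\<close>-th powers of distinct primes, distinct monomials
  take the \<open>j\<close>-th powers of distinct integers.\<close>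

lemma mpoly_nonzero_at_integer_point:
  fixes f :: "('n::finite, int) mpoly"
  assumes "f \<noteq> 0"
  obtains x :: "'n \<Rightarrow> int" where "mpoly_eval (\<lambda>c. c) x f \<noteq> 0"
proof -
  obtain \<pi> :: "nat \<Rightarrow> nat" where \<pi>: "inj \<pi>" "\<And>i. prime (\<pi> i)"
    using infinite_countable_subset[OF primes_infinite] by (metis mem_Collect_eq range_subsetD)
  obtain e :: "'n \<Rightarrow> nat" where e: "inj e"
    using finite_imp_inj_to_nat_seg[of "UNIV :: 'n set"] by auto
  define r where "r v = \<pi> (e v)" for v
  have r: "inj r" "\<And>v. prime (r v)" using \<pi> e by (auto simp: r_def inj_def)
  define W where "W m = (\<Prod>v\<in>UNIV. r v ^ Poly_Mapping.lookup m v)" for m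
  \<comment> \<open>By unique factorization the exponents of \<open>m\<close> can be read off from
    \<open>W m\<close>, so \<open>W\<close> is injective.\<close>
  have mult: "multiplicity (r v) (W m) = Poly_Mapping.lookup m v" for m v
  proof -
    have "W m = (\<Prod>p\<in>range r. p ^ Poly_Mapping.lookup m (inv r p))"
      unfolding W_def by (subst prod.reindex) (use r in auto)
    then show ?thesis
      using multiplicity_prod_prime_powers[of "range r" "r v" "\<lambda>p. Poly_Mapping.lookup m (inv r p)"] r
      by auto
  qed
  have "inj W" by (rule injI) (metis mult poly_mapping_eqI)
  then have inj: "inj_on (\<lambda>m. int (W m)) (Poly_Mapping.keys f)" by (auto simp: inj_on_def)
  have ev: "monomial_eval (\<lambda>v. int (r v) ^ j) m = int (W m) ^ j" for j m
    by (simp add: monomial_eval_superset[of UNIV] W_def prod_power_distrib mult.commute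
        flip: power_mult)
  obtain m where m: "m \<in> Poly_Mapping.keys f" using assms by fastforce
  have "\<exists>j. mpoly_eval (\<lambda>c. c) (\<lambda>v. int (r v) ^ j) f \<noteq> 0"
  proof (rule ccontr)
    assume "\<not> ?thesis"
    then have "(\<Sum>m\<in>Poly_Mapping.keys f. Poly_Mapping.lookup f m * int (W m) ^ j) = 0" for j
      by (simp add: mpoly_eval_def ev)
    from sum_powers_eq_0_imp_coeff_0[OF _ inj this m] m show False
      by (simp add: in_keys_iff)
  qed
  then show ?thesis using that by blast
qed

section \<open>Rationality and scaling of evaluated forms\<close>

lemma mpoly_eval_of_int:
  "mpoly_eval of_int (\<lambda>v. of_int (x v)) f = (of_int (mpoly_eval (\<lambda>c. c) x f) :: 'r::comm_ring_1)"
  by (simp add: mpoly_eval_def monomial_eval_def)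

lemma mpoly_eval_in_Rats:
  "(\<And>v. x v \<in> \<rat>) \<Longrightarrow> mpoly_eval of_int x f \<in> (\<rat> :: complex set)"
  unfolding mpoly_eval_def monomial_eval_def
  by (intro Rats_sum Rats_mult Rats_of_int Rats_prod Rats_power)

lemma monomial_eval_scale:
  "monomial_eval (\<lambda>v. t * x v) m = t ^ monomial_degree m * monomial_eval x m"
  by (simp add: monomial_eval_def monomial_degree_def power_mult_distrib prod.distrib power_sum)

lemma homogeneous_monomial_degree:
  assumes "homogeneous f" "m \<in> Poly_Mapping.keys f"
  shows "monomial_degree m = total_degree f"
proof -
  obtain d where d: "\<And>m. m \<in> Poly_Mapping.keys f \<Longrightarrow> monomial_degree m = d"
    using assms(1) unfolding homogeneous_def by blast
  have "monomial_degree ` Poly_Mapping.keys f = {d}" using d assms(2) by force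
  then show ?thesis using d assms(2) by (simp add: total_degree_def)
qed

lemma mpoly_eval_scale:
  assumes "homogeneous f"
  shows "mpoly_eval h (\<lambda>v. t * x v) f = t ^ total_degree f * mpoly_eval h x f"
  unfolding mpoly_eval_def sum_distrib_left
  by (rule sum.cong)
    (auto simp: monomial_eval_scale homogeneous_monomial_degree[OF assms])

section \<open>Fourth roots along a limit\<close>

lemma csqrt_csqrt_power4: "csqrt (csqrt z) ^ 4 = z"
  using power_mult[of "csqrt (csqrt z)" 2 2] by simp

text \<open>For \<open>y = 0\<close> any choice of roots works, since their norms tend to 0.
  Otherwise division by \<open>y ^ 4\<close> moves the limit to 1, where the principal square root
  is continuous.\<close>

lemma fourth_root_tendsto:
  fixes y :: complex
  assumes "(f \<longlongrightarrow> y ^ 4) F"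
  obtains g where "\<And>t. g t ^ 4 = f t" "(g \<longlongrightarrow> y) F"
proof (cases "y = 0")
  case True
  define g where "g t = csqrt (csqrt (f t))" for t
  have g: "g t ^ 4 = f t" for t
    by (simp add: g_def csqrt_csqrt_power4)
  have "((\<lambda>t. root 4 (norm (f t))) \<longlongrightarrow> root 4 (norm (y ^ 4))) F"
    by (intro tendsto_intros assms)
  moreover have "root 4 (norm (f t)) = norm (g t)" for t
    by (simp add: norm_power real_root_power_cancel flip: g)
  ultimately have "((\<lambda>t. norm (g t)) \<longlongrightarrow> 0) F" using True by simp
  then have "(g \<longlongrightarrow> y) F" using True tendsto_norm_zero_cancel by blast
  then show ?thesis using that g by blast
next
  case False
  define g where "g t = y * csqrt (csqrt (f t / y ^ 4))" for t
  have g: "g t ^ 4 = f t" for t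
    using False by (simp add: g_def power_mult_distrib csqrt_csqrt_power4)
  have "((\<lambda>t. f t / y ^ 4) \<longlongrightarrow> y ^ 4 / y ^ 4) F"
    using False by (intro tendsto_intros assms) auto
  then have l: "((\<lambda>t. f t / y ^ 4) \<longlongrightarrow> 1) F" using False by simp
  have c: "isCont csqrt 1" by (rule continuous_at_csqrt) simp
  have "((\<lambda>t. csqrt (f t / y ^ 4)) \<longlongrightarrow> 1) F"
    using isCont_tendsto_compose[OF c l] by simp
  then have "((\<lambda>t. csqrt (csqrt (f t / y ^ 4))) \<longlongrightarrow> 1) F"
    using isCont_tendsto_compose[OF c] by fastforce
  then have "(g \<longlongrightarrow> y * 1) F" unfolding g_def by (intro tendsto_intros)
  then show ?thesis using that[OF g] by simp
qed

section \<open>Complex values of rational polynomials\<close>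

lemma poly_map_poly_of_rat:
  fixes t :: "'a::field_char_0"
  shows "poly (map_poly of_rat (p + q)) t = poly (map_poly of_rat p) t + poly (map_poly of_rat q) t"
    and "poly (map_poly of_rat (p - q)) t = poly (map_poly of_rat p) t - poly (map_poly of_rat q) t"
    and "poly (map_poly of_rat (p * q)) t = poly (map_poly of_rat p) t * poly (map_poly of_rat q) t"
    and "poly (map_poly of_rat (smult c p)) t = of_rat c * poly (map_poly of_rat p) t"
    and "poly (map_poly of_rat (pCons c p)) t = of_rat c + t * poly (map_poly of_rat p) t"
    and "poly (map_poly of_rat (p ^ n)) t = poly (map_poly of_rat p) t ^ n"
proof -
  have add: "map_poly of_rat (p + q) = (map_poly of_rat p + map_poly of_rat q :: 'a poly)" for p q
    by (rule poly_eqI) (simp add: coeff_map_poly of_rat_add)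
  have diff: "map_poly of_rat (p - q) = (map_poly of_rat p - map_poly of_rat q :: 'a poly)" for p q
    by (rule poly_eqI) (simp add: coeff_map_poly of_rat_diff)
  have mult: "map_poly of_rat (p * q) = (map_poly of_rat p * map_poly of_rat q :: 'a poly)" for p q
    by (rule poly_eqI) (simp add: coeff_map_poly coeff_mult of_rat_sum of_rat_mult)
  show "poly (map_poly of_rat (p + q)) t = poly (map_poly of_rat p) t + poly (map_poly of_rat q) t"
    and "poly (map_poly of_rat (p - q)) t = poly (map_poly of_rat p) t - poly (map_poly of_rat q) t"
    and "poly (map_poly of_rat (p * q)) t = poly (map_poly of_rat p) t * poly (map_poly of_rat q) t"
    by (simp_all add: add diff mult)
  show "poly (map_poly of_rat (smult c p)) t = of_rat c * poly (map_poly of_rat p) t"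
    and "poly (map_poly of_rat (pCons c p)) t = of_rat c + t * poly (map_poly of_rat p) t"
    by (simp_all add: map_poly_smult map_poly_pCons of_rat_mult)
  show "poly (map_poly of_rat (p ^ n)) t = poly (map_poly of_rat p) t ^ n"
    by (induction n) (simp_all add: mult map_poly_1)
qed

section \<open>The equation of the hypersurface and its two forms\<close>

locale quartic_hypersurface =
  fixes a b :: int and f1 f2 :: "('n::finite, int) mpoly"
  assumes a: "a \<noteq> 0" and b: "b \<noteq> 0"
    and f1: "f1 \<noteq> 0" "homogeneous f1"
    and f2: "f2 \<noteq> 0" "homogeneous f2"
    and deg: "total_degree f2 = 2 * total_degree f1 + 1"
begin

definition k :: complex where "k = of_int a / of_int b"

definition d :: nat where "d = total_degree f1"

definition F :: "('n \<Rightarrow> complex) \<Rightarrow> complex" where "F x = mpoly_eval of_int x f1"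

definition G :: "('n \<Rightarrow> complex) \<Rightarrow> complex" where "G x = mpoly_eval of_int x f2"

lemma k_nonzero: "k \<noteq> 0"
  using a b by (simp add: k_def)

lemma mem_W_iff:
  "p \<in> hypersurface_W a b f1 f2 \<longleftrightarrow>
    p Y2 ^ 4 = k * (p Y1 ^ 4 - F (\<lambda>i. p (X i)) ^ 4) + G (\<lambda>i. p (X i)) ^ 2"
  using b by (auto simp: hypersurface_W_def k_def F_def G_def field_simps)

lemma F_scale: "F (\<lambda>i. t * x i) = t ^ d * F x"
  using mpoly_eval_scale[OF f1(2)] by (simp add: F_def d_def)

lemma G_scale: "G (\<lambda>i. t * x i) = t ^ (2 * d + 1) * G x"
  using mpoly_eval_scale[OF f2(2)] by (simp add: G_def d_def deg)

lemma polyfun_F: "(\<And>i. polyfun (g i)) \<Longrightarrow> polyfun (\<lambda>x. F (\<lambda>i. g i x))"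
  unfolding F_def by (rule polyfun_mpoly_eval)

lemma polyfun_G: "(\<And>i. polyfun (g i)) \<Longrightarrow> polyfun (\<lambda>x. G (\<lambda>i. g i x))"
  unfolding G_def by (rule polyfun_mpoly_eval)

lemma polyfun_FG: "polyfun F" "polyfun G"
  using polyfun_F[of "\<lambda>i x. x i"] polyfun_G[of "\<lambda>i x. x i"] by (simp_all add: polyfun.coord)

lemma closedin_W: "closedin zariski (hypersurface_W a b f1 f2)"
proof -
  have "hypersurface_W a b f1 f2 = {p. p Y2 ^ 4 -
     (k * (p Y1 ^ 4 - F (\<lambda>i. p (X i)) ^ 4) + G (\<lambda>i. p (X i)) ^ 2) = 0}"
    by (auto simp: mem_W_iff)
  then show ?thesis
    by (simp only:) (intro closedin_zariski_polyfun polyfun_intros polyfun_F polyfun_G)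
qed

text \<open>Each form, being formally nonzero, is nonzero at some integer point; a line joining two
  such points serves both forms.\<close>

lemma exists_FG_nonzero:
  obtains x where "F x \<noteq> 0" "G x \<noteq> 0"
proof -
  obtain x where "mpoly_eval (\<lambda>c. c) x f1 \<noteq> 0" using mpoly_nonzero_at_integer_point[OF f1(1)] .
  then have x: "F (\<lambda>v. of_int (x v)) \<noteq> 0" by (simp add: F_def mpoly_eval_of_int)
  obtain y where "mpoly_eval (\<lambda>c. c) y f2 \<noteq> 0" using mpoly_nonzero_at_integer_point[OF f2(1)] .
  then have y: "G (\<lambda>v. of_int (y v)) \<noteq> 0" by (simp add: G_def mpoly_eval_of_int)
  show ?thesis
    using polyfun_nonzero_mult[of F "\<lambda>v. of_int (x v)" G "\<lambda>v. of_int (y v)"]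
      polyfun_FG x y that by metis
qed

lemma exists_rational_FG_nonzero:
  obtains x where "\<And>i. x i \<in> \<rat>" "F x \<noteq> 0" "G x \<noteq> 0"
proof -
  obtain z where z: "F z \<noteq> 0" "G z \<noteq> 0" using exists_FG_nonzero .
  have "\<exists>x. (\<forall>i. x i \<in> \<rat>) \<and> F x * G x \<noteq> 0"
  proof (rule ccontr)
    assume "\<not> ?thesis"
    then have "F x * G x = 0" if "\<And>i. x i \<in> \<rat>" for x using that by blast
    from polyfun_eq_0_if_rational[OF polyfun.mult[OF polyfun_FG] this] have "F z * G z = 0" .
    then show False using z by simp
  qed
  then show ?thesis using that by auto
qed

section \<open>The conic bundle and its parametrization\<close>

text \<open>With \<open>c = k s\<^sup>4\<close> and \<open>Q = s q\<close> the conic is \<open>2 Q\<^sup>2 = (1 - c) + (1 + c) p\<^sup>2\<close>. The line of slope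
  \<open>m\<close> through \<open>(p, Q) = (1, 1)\<close> meets it again at \<open>p = Pn / Dn\<close>, \<open>Q = Qn / Dn\<close>, and then
  \<open>w = Wn / (s\<^sup>2 Dn\<^sup>2)\<close>.\<close>

definition cf :: "complex \<Rightarrow> complex" where "cf s = k * s ^ 4"

definition Dn :: "complex \<Rightarrow> complex \<Rightarrow> complex" where "Dn s m = 2 * m\<^sup>2 - (1 + cf s)"

definition Pn :: "complex \<Rightarrow> complex \<Rightarrow> complex" where "Pn s m = 2 * m\<^sup>2 - 4 * m + (1 + cf s)"

definition Qn :: "complex \<Rightarrow> complex \<Rightarrow> complex" where
  "Qn s m = 2 * (1 + cf s) * m - 2 * m\<^sup>2 - (1 + cf s)"

text \<open>This is \<open>w = q^2 + k * s^2 * (1 - p^2)\<close> multiplied by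
  \<open>s^2 * Dn^2\<close>.\<close>

definition Wn :: "complex \<Rightarrow> complex \<Rightarrow> complex" where
  "Wn s m = (Qn s m)\<^sup>2 + cf s * ((Dn s m)\<^sup>2 - (Pn s m)\<^sup>2)"

text \<open>The factor \<open>t\<close> on the ray through \<open>x\<close>, solved from
  \<open>t * G x = (F x)^2 * w\<close>.\<close>

definition scale :: "('n \<Rightarrow> complex) \<Rightarrow> complex \<Rightarrow> complex \<Rightarrow> complex" where
  "scale x s m = (F x)\<^sup>2 * Wn s m / (G x * s\<^sup>2 * (Dn s m)\<^sup>2)"

definition param :: "('n \<Rightarrow> complex) \<Rightarrow> complex \<Rightarrow> complex \<Rightarrow> 'n coord \<Rightarrow> complex" where
  "param x s m v = (case v of
      X i \<Rightarrow> scale x s m * x i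
    | Y1 \<Rightarrow> scale x s m ^ d * F x * (Pn s m / Dn s m)
    | Y2 \<Rightarrow> scale x s m ^ d * F x * (Qn s m / (s * Dn s m)))"

lemma param_simps [simp]:
  "param x s m (X i) = scale x s m * x i"
  "param x s m Y1 = scale x s m ^ d * F x * (Pn s m / Dn s m)"
  "param x s m Y2 = scale x s m ^ d * F x * (Qn s m / (s * Dn s m))"
  by (simp_all add: param_def)

text \<open>The point \<open>(Pn / Dn, Qn / Dn)\<close> lies on the conic, denominators
  cleared.\<close>

lemma conic_identity: "2 * (Qn s m)\<^sup>2 + cf s * ((Dn s m)\<^sup>2 - (Pn s m)\<^sup>2) = (Dn s m)\<^sup>2 + (Pn s m)\<^sup>2"
  unfolding Qn_def Dn_def Pn_def by algebra

text \<open>\<open>Wn - Qn^2\<close> is \<open>cf s * (Dn^2 - Pn^2)\<close> by definition, and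
  \<open>Wn + Qn^2\<close> is \<open>Dn^2 + Pn^2\<close> by \<open>conic_identity\<close>; the claim
  is their product.\<close>

lemma Wn_square: "(Wn s m)\<^sup>2 = Qn s m ^ 4 + k * s ^ 4 * (Dn s m ^ 4 - Pn s m ^ 4)"
  using conic_identity[of s m] unfolding Wn_def cf_def by algebra

lemma param_in_W:
  assumes "s \<noteq> 0" "Dn s m \<noteq> 0" "G x \<noteq> 0"
  shows "param x s m \<in> hypersurface_W a b f1 f2"
proof -
  define E where "E = (scale x s m ^ d) ^ 4"
  define w where "w = Wn s m / (s\<^sup>2 * (Dn s m)\<^sup>2)"
  define p where "p = Pn s m / Dn s m"
  define q where "q = Qn s m / (s * Dn s m)"
  have "Wn s m = w * (s\<^sup>2 * (Dn s m)\<^sup>2)" "Pn s m = p * Dn s m" "Qn s m = q * (s * Dn s m)"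
    using assms by (simp_all add: w_def p_def q_def)
  with Wn_square[of s m] have "s ^ 4 * Dn s m ^ 4 * w\<^sup>2 = s ^ 4 * Dn s m ^ 4 * (q ^ 4 + k * (1 - p ^ 4))"
    by algebra
  then have w2: "w\<^sup>2 = q ^ 4 + k * (1 - p ^ 4)" using assms by simp
  have sc: "scale x s m * G x = (F x)\<^sup>2 * w" using assms by (simp add: scale_def w_def)
  \<comment> \<open>Here the degree condition acts: the square of \<open>G\<close> and the fourth
    powers of \<open>F\<close>, \<open>Y1\<close>, \<open>Y2\<close> all carry the same factor
    \<open>E\<close>, the power \<open>4 * d\<close> of the scale.\<close>
  have "(scale x s m ^ (2 * d + 1) * G x)\<^sup>2 = E * (scale x s m * G x)\<^sup>2"
    by (simp add: E_def power_mult_distrib power_add flip: power_mult) (simp add: mult_ac)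
  also have "\<dots> = E * F x ^ 4 * w\<^sup>2" unfolding sc by algebra
  finally have "(scale x s m ^ (2 * d + 1) * G x)\<^sup>2 = E * F x ^ 4 * w\<^sup>2" .
  then show ?thesis
    unfolding mem_W_iff param_simps F_scale G_scale
    by (simp only: w2 power_mult_distrib flip: E_def p_def q_def) (simp add: algebra_simps)
qed

lemma param_rational:
  assumes "\<And>i. x i \<in> \<rat>" "s \<in> \<rat>" "m \<in> \<rat>"
  shows "param x s m v \<in> \<rat>"
proof -
  have "F x \<in> \<rat>" "G x \<in> \<rat>" using assms(1) by (simp_all add: F_def G_def mpoly_eval_in_Rats)
  then show ?thesis using assms
    by (cases v) (auto simp: scale_def Wn_def Qn_def Pn_def Dn_def cf_def k_def
       intro!: Rats_mult Rats_divide Rats_power Rats_add Rats_diff)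
qed

text \<open>The inverse construction, with \<open>x\<close> itself as direction and scale 1:
  \<open>z\<close> gives \<open>p\<close>, \<open>q\<close>, \<open>w\<close>, then the fibre
  parameter \<open>s\<close> of the conic bundle, then the slope \<open>m\<close>. The hypotheses
  avoid \<open>z Y2\<close>, which lets the density proof choose it freely as a fourth root.\<close>

lemma param_surj:
  assumes W: "z \<in> hypersurface_W a b f1 f2"
    and x: "x = (\<lambda>i. z (X i))" and nz: "F x \<noteq> 0" "G x \<noteq> 0"
    and g1: "z Y1 ^ 4 \<noteq> F x ^ 4" and g2: "k * z Y1 ^ 4 + (G x)\<^sup>2 \<noteq> 0"
    and g3: "(G x)\<^sup>2 \<noteq> k * F x ^ 4"
  obtains s m where "s \<noteq> 0" "Dn s m \<noteq> 0" "z = param x s m"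
proof -
  define p where "p = z Y1 / F x"
  define q where "q = z Y2 / F x"
  define w where "w = G x / (F x)\<^sup>2"
  have zy: "z Y1 = p * F x" "z Y2 = q * F x" "G x = w * (F x)\<^sup>2"
    using nz by (simp_all add: p_def q_def w_def)
  have "z Y2 ^ 4 = k * (z Y1 ^ 4 - F x ^ 4) + (G x)\<^sup>2" using W x by (simp add: mem_W_iff)
  then have "F x ^ 4 * w\<^sup>2 = F x ^ 4 * (q ^ 4 + k * (1 - p ^ 4))" unfolding zy by algebra
  then have w2: "w\<^sup>2 = q ^ 4 + k * (1 - p ^ 4)" using nz by simp
  have p4: "p ^ 4 \<noteq> 1" using g1 by (auto simp: zy power_mult_distrib)
  \<comment> \<open>By \<open>w2\<close>, \<open>q^4 + k = w^2 + k * p^4\<close> and, for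
    \<open>gen3\<close>, \<open>q^4 - k * p^4 = w^2 - k\<close>, so \<open>g2\<close> and
    \<open>g3\<close> suffice.\<close>
  have gen2: "q ^ 4 + k \<noteq> 0"
  proof
    assume "q ^ 4 + k = 0"
    with w2 have "k * z Y1 ^ 4 + (G x)\<^sup>2 = 0" unfolding zy by algebra
    with g2 show False by simp
  qed
  have gen3: "q ^ 4 \<noteq> k * p ^ 4"
  proof
    assume "q ^ 4 = k * p ^ 4"
    with w2 have "(G x)\<^sup>2 = k * F x ^ 4" unfolding zy by algebra
    with g3 show False by simp
  qed
  have p2: "1 - p\<^sup>2 \<noteq> 0" using p4 by algebra
  \<comment> \<open>Chosen so that \<lambda> \<open>= k * s^2\<close> is the quotient of
    \<open>w - q^2\<close> by \<open>1 - p^2\<close>.\<close>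
  define s where "s = csqrt ((w - q\<^sup>2) / (1 - p\<^sup>2) / k)"
  have "s\<^sup>2 = (w - q\<^sup>2) / (1 - p\<^sup>2) / k" by (simp add: s_def)
  then have ws: "w = q\<^sup>2 + k * s\<^sup>2 * (1 - p\<^sup>2)" using p2 k_nonzero by (simp add: field_simps)
  have s0: "s \<noteq> 0"
  proof
    assume "s = 0"
    then have "k * (1 - p ^ 4) = 0" using w2 ws by simp
    then show False using k_nonzero p4 by simp
  qed
  \<comment> \<open>\<open>w2\<close> factors as
    \<open>(w - q^2) * (w + q^2) = k * (1 - p^2) * (1 + p^2)\<close>, and \<open>ws\<close> replaces
    \<open>w\<close>.\<close>
  have "k * (1 - p\<^sup>2) * (2 * s\<^sup>2 * q\<^sup>2 + k * s ^ 4 * (1 - p\<^sup>2)) = k * (1 - p\<^sup>2) * (1 + p\<^sup>2)"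
    using w2 ws by algebra
  then have conic: "2 * s\<^sup>2 * q\<^sup>2 + k * s ^ 4 * (1 - p\<^sup>2) = 1 + p\<^sup>2" using k_nonzero p2 by simp
  define m where "m = (s * q - 1) / (p - 1)"
  have p1: "p - 1 \<noteq> 0" using p4 by auto
  have sq: "s * q = 1 + m * (p - 1)" using p1 by (simp add: m_def)
  \<comment> \<open>Substituting the line into the conic gives a quadratic in \<open>p - 1\<close>
    without constant term; the known root is cancelled next.\<close>
  have "(p - 1) * ((p - 1) * Dn s m) = (p - 1) * (2 * (1 + cf s) - 4 * m)"
    using conic sq unfolding Dn_def cf_def by algebra
  then have line: "(p - 1) * Dn s m = 2 * (1 + cf s) - 4 * m" using p1 by simp
  \<comment> \<open>\<open>Dn s m = 0\<close> would force \<open>cf s\<close> to be -1 or 1, where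
    the conic splits into two lines, with the point on the component \<open>s * q = 1\<close> or
    \<open>s * q = p\<close>. These are excluded by \<open>gen2\<close> and
    \<open>gen3\<close>.\<close>
  have Dn0: "Dn s m \<noteq> 0"
  proof
    assume D: "Dn s m = 0"
    then have "2 * (1 + cf s) = 2 * (2 * m)" using line by simp
    then have c: "1 + cf s = 2 * m" by (simp only: mult_cancel_left) simp
    with D have "m * (m - 1) = 0" unfolding Dn_def by algebra
    then consider "m = 0" | "m = 1" by auto
    then show False
    proof cases
      case 1
      then have "k * s ^ 4 = -1" "s * q = 1" using c sq unfolding cf_def by (auto simp: add_eq_0_iff)
      then have "s ^ 4 * (q ^ 4 + k) = 0" by algebra
      then show False using gen2 s0 by simp
    next
      case 2
      then have "k * s ^ 4 = 1" "s * q = p" using c sq unfolding cf_def by auto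
      then have "s ^ 4 * (q ^ 4 - k * p ^ 4) = 0" by algebra
      then show False using gen3 s0 by simp
    qed
  qed
  have P: "Pn s m = p * Dn s m" using line unfolding Pn_def Dn_def by algebra
  have Q: "Qn s m = q * (s * Dn s m)" using line sq unfolding Qn_def Dn_def by algebra
  have "Wn s m = w * s\<^sup>2 * (Dn s m)\<^sup>2" using ws P Q unfolding Wn_def cf_def by algebra
  then have sc: "scale x s m = 1" using nz s0 Dn0 by (simp add: scale_def w_def)
  have "z v = param x s m v" for v
    unfolding param_def sc P Q using s0 Dn0 by (cases v) (simp_all add: zy, simp add: x)
  then show ?thesis using that s0 Dn0 by blast
qed

text \<open>The pullback of \<open>f\<close> to \<open>(x, s, m)\<close>-space is regular where the
  parametrization is defined and vanishes at the rational points there, which map to rational points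
  of the hypersurface.\<close>

lemma polyfun_vanishing_at_param:
  assumes f: "polyfun f" and rat: "\<And>y. y \<in> rational_points (hypersurface_W a b f1 f2) \<Longrightarrow> f y = 0"
    and "s \<noteq> 0" "Dn s m \<noteq> 0" "G x \<noteq> 0"
  shows "f (param x s m) = 0"
proof -
  let ?x = "\<lambda>u :: 'n coord \<Rightarrow> complex. (\<lambda>i. u (X i))"
  \<comment> \<open>\<open>(x, s, m)\<close>-space reuses the index type \<open>'n coord\<close>,
    with \<open>s\<close> at \<open>Y1\<close> and \<open>m\<close> at \<open>Y2\<close>;
    \<open>h\<close> collects all denominators.\<close>
  define h where "h u = G (?x u) * u Y1 * Dn (u Y1) (u Y2)" for u
  have poly_c: "polyfun (\<lambda>u :: 'n coord \<Rightarrow> complex. cf (u Y1))"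
    unfolding cf_def by (intro polyfun_intros)
  have poly_D: "polyfun (\<lambda>u :: 'n coord \<Rightarrow> complex. Dn (u Y1) (u Y2))"
    unfolding Dn_def by (intro polyfun_intros poly_c)
  have poly_P: "polyfun (\<lambda>u :: 'n coord \<Rightarrow> complex. Pn (u Y1) (u Y2))"
    unfolding Pn_def by (intro polyfun_intros poly_c)
  have poly_Q: "polyfun (\<lambda>u :: 'n coord \<Rightarrow> complex. Qn (u Y1) (u Y2))"
    unfolding Qn_def by (intro polyfun_intros poly_c)
  have poly_W: "polyfun (\<lambda>u :: 'n coord \<Rightarrow> complex. Wn (u Y1) (u Y2))"
    unfolding Wn_def by (intro polyfun_intros poly_c poly_D poly_P poly_Q)
  have poly_F: "polyfun (\<lambda>u. F (?x u))" and poly_G: "polyfun (\<lambda>u. G (?x u))"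
    by (intro polyfun_F polyfun_G polyfun.coord)+
  have poly_h: "polyfun h" unfolding h_def by (intro polyfun_intros poly_D poly_G)
  have inv: "regular_off h (\<lambda>u. 1 / h u)"
    by (rule regular_off_divide[where e = "\<lambda>u. 1"]) (auto intro: polyfun.const poly_h)
  have scale: "regular_off h (\<lambda>u. scale (?x u) (u Y1) (u Y2))"
  proof -
    \<comment> \<open>\<open>(h u)^2\<close> has one factor \<open>G\<close> too many, restored in
      the numerator. The identity holds even where \<open>h u = 0\<close>, both sides then being
      0.\<close>
    have "scale (?x u) (u Y1) (u Y2) = (F (?x u))\<^sup>2 * Wn (u Y1) (u Y2) * G (?x u) * (1 / h u)\<^sup>2" for u
      by (simp add: scale_def h_def power_mult_distrib power_divide power2_eq_square[of "G _"])
    then show ?thesis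
      by (simp only:) (intro regular_off_mult regular_off_power inv regular_off_polyfun poly_F poly_G poly_W)
  qed
  have PD: "regular_off h (\<lambda>u. Pn (u Y1) (u Y2) / Dn (u Y1) (u Y2))"
    by (rule regular_off_divide[where e = "\<lambda>u. G (?x u) * u Y1"])
      (auto simp: h_def intro: polyfun_intros poly_P poly_D poly_G)
  have QD: "regular_off h (\<lambda>u. Qn (u Y1) (u Y2) / (u Y1 * Dn (u Y1) (u Y2)))"
    by (rule regular_off_divide[where e = "\<lambda>u. G (?x u)"])
      (auto simp: h_def intro: polyfun_intros poly_Q poly_D poly_G)
  have "regular_off h (\<lambda>u. param (?x u) (u Y1) (u Y2) v)" for v
    by (cases v; simp only: param_simps;
        intro regular_off_mult regular_off_power scale PD QD regular_off_polyfun[OF poly_F]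
          regular_off_polyfun[OF polyfun.coord])
  then have reg: "regular_off h (\<lambda>u. f (param (?x u) (u Y1) (u Y2)))"
    by (rule regular_off_compose[OF f poly_h])
  define u where "u v = (case v of X i \<Rightarrow> x i | Y1 \<Rightarrow> s | Y2 \<Rightarrow> m)" for v
  have "f (param (?x u) (u Y1) (u Y2)) = 0"
  proof (rule regular_off_eq_0_if_rational[OF poly_h reg])
    show "f (param (?x y) (y Y1) (y Y2)) = 0" if "\<And>v. y v \<in> \<rat>" "h y \<noteq> 0" for y
    proof (rule rat)
      show "param (?x y) (y Y1) (y Y2) \<in> rational_points (hypersurface_W a b f1 f2)"
        using that param_rational[of "?x y"] param_in_W[of "y Y1" "y Y2" "?x y"]
        by (auto simp: rational_points_def h_def)
    qed
    show "h u \<noteq> 0" using assms by (simp add: h_def u_def)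
  qed
  then show ?thesis by (simp add: u_def)
qed

section \<open>Density of the rational points\<close>

text \<open>Every condition excluding a point from the image of the parametrization depends on
  \<open>(x, y\<^sub>1)\<close> only, so an excluded point is approached by points over a generic line in
  \<open>(x, y\<^sub>1)\<close>-space, choosing the fourth root \<open>y\<^sub>2\<close> continuously.\<close>

lemma rational_points_dense:
  "hypersurface_W a b f1 f2 \<subseteq> zariski closure_of rational_points (hypersurface_W a b f1 f2)"
proof
  fix z assume z: "z \<in> hypersurface_W a b f1 f2"
  let ?x = "\<lambda>u :: 'n coord \<Rightarrow> complex. (\<lambda>i. u (X i))"
  \<comment> \<open>The factors are the genericity hypotheses of \<open>param_surj\<close>.\<close>
  define h where "h u = F (?x u) * G (?x u) * (u Y1 ^ 4 - F (?x u) ^ 4)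
     * (k * u Y1 ^ 4 + (G (?x u))\<^sup>2) * ((G (?x u))\<^sup>2 - k * F (?x u) ^ 4)" for u
  have poly_F: "polyfun (\<lambda>u. F (?x u))" and poly_G: "polyfun (\<lambda>u. G (?x u))"
    by (intro polyfun_F polyfun_G polyfun.coord)+
  have poly_h: "polyfun h" unfolding h_def by (intro polyfun_intros poly_F poly_G)
  obtain g where g: "h g \<noteq> 0"
  proof -
    obtain x0 where x0: "F x0 \<noteq> 0" "G x0 \<noteq> 0" using exists_FG_nonzero .
    \<comment> \<open>Scaling \<open>x0\<close> by \<open>t\<close> turns
      \<open>G^2 - k * F^4\<close> into a power of \<open>t\<close> times this quadratic in
      \<open>t\<close>; the factor \<open>[:0, 1:]\<close> secures
      \<open>t \<noteq> 0\<close>.\<close>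
    have "[:- (k * F x0 ^ 4), 0, (G x0)\<^sup>2:] * [:0, 1:] \<noteq> 0" using x0 by simp
    then obtain t where "poly ([:- (k * F x0 ^ 4), 0, (G x0)\<^sup>2:] * [:0, 1:]) t \<noteq> 0"
      using poly_nonzero_point by blast
    then have t: "t \<noteq> 0" "(t * G x0)\<^sup>2 - k * F x0 ^ 4 \<noteq> 0"
      by (simp_all del: mult_pCons_left mult_pCons_right add: power2_eq_square algebra_simps)
    define F1 G1 where "F1 = t ^ d * F x0" and "G1 = t ^ (2 * d + 1) * G x0"
    have "G1\<^sup>2 - k * F1 ^ 4 = (t ^ d) ^ 4 * ((t * G x0)\<^sup>2 - k * F x0 ^ 4)"
      by (simp add: F1_def G1_def power_mult_distrib power_add algebra_simps flip: power_mult)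
    then have 1: "F1 \<noteq> 0" "G1 \<noteq> 0" "G1\<^sup>2 - k * F1 ^ 4 \<noteq> 0"
      using t x0 by (simp_all add: F1_def G1_def)
    have "[:- (F1 ^ 4), 0, 0, 0, 1:] * [:G1\<^sup>2, 0, 0, 0, k:] \<noteq> 0" using k_nonzero by simp
    then obtain y where "poly ([:- (F1 ^ 4), 0, 0, 0, 1:] * [:G1\<^sup>2, 0, 0, 0, k:]) y \<noteq> 0"
      using poly_nonzero_point by blast
    then have y: "y ^ 4 - F1 ^ 4 \<noteq> 0" "k * y ^ 4 + G1\<^sup>2 \<noteq> 0"
      by (auto simp del: mult_pCons_left mult_pCons_right simp: power4_eq_xxxx ac_simps)
    have "h (\<lambda>v. case v of X i \<Rightarrow> t * x0 i | _ \<Rightarrow> y) \<noteq> 0"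
      unfolding h_def coord.case F_scale G_scale F1_def[symmetric] G1_def[symmetric] using 1 y
      by simp
    then show ?thesis using that by blast
  qed
  \<comment> \<open>The value that the equation prescribes for \<open>u Y2 ^ 4\<close>.\<close>
  define D where "D u = k * (u Y1 ^ 4 - F (?x u) ^ 4) + G (?x u) ^ 2" for u
  have poly_D: "polyfun D" unfolding D_def by (intro polyfun_intros poly_F poly_G)
  define l where "l t = (\<lambda>v. z v + t * (g v - z v))" for t
  have l0: "l 0 = z" by (simp add: l_def)
  obtain ph where ph: "\<And>t. h (l t) = poly ph t"
    using polyfun_line[OF poly_h, of z g] unfolding l_def by blast
  obtain pD where pD: "\<And>t. D (l t) = poly pD t"
    using polyfun_line[OF poly_D, of z g] unfolding l_def by blast
  have "ph \<noteq> 0" using ph[of 1] g by (auto simp: l_def)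
  then have fin: "finite {t. poly ph t = 0}" by (rule poly_roots_finite)
  show "z \<in> zariski closure_of rational_points (hypersurface_W a b f1 f2)"
  proof (rule zariski_closure_ofI)
    fix f assume f: "polyfun f" and rat: "\<And>y. y \<in> rational_points (hypersurface_W a b f1 f2) \<Longrightarrow> f y = 0"
    have "((\<lambda>t. D (l t)) \<longlongrightarrow> poly pD 0) (at 0)"
      unfolding pD using poly_isCont isCont_def by blast
    moreover have "poly pD 0 = z Y2 ^ 4"
      using z by (simp add: pD[symmetric] l0 D_def mem_W_iff)
    ultimately obtain r where r: "\<And>t. r t ^ 4 = D (l t)" "(r \<longlongrightarrow> z Y2) (at 0)"
      using fourth_root_tendsto by metis
    \<comment> \<open>The line \<open>l\<close> need not lie on the hypersurface; correcting its
      last coordinate puts it there and keeps the limit \<open>z\<close>.\<close>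
    define y where "y t = (l t)(Y2 := r t)" for t
    have yx: "?x (y t) = ?x (l t)" "y t Y1 = l t Y1" for t by (simp_all add: y_def)
    have zero: "f (y t) = 0" if "h (l t) \<noteq> 0" for t
    proof -
      have "y t \<in> hypersurface_W a b f1 f2"
        unfolding mem_W_iff yx using r(1)[of t] by (simp add: D_def y_def)
      moreover have "F (?x (l t)) \<noteq> 0" "G (?x (l t)) \<noteq> 0" "l t Y1 ^ 4 \<noteq> F (?x (l t)) ^ 4"
        "k * l t Y1 ^ 4 + (G (?x (l t)))\<^sup>2 \<noteq> 0" "(G (?x (l t)))\<^sup>2 \<noteq> k * F (?x (l t)) ^ 4"
        using that by (auto simp: h_def)
      ultimately obtain s m where "s \<noteq> 0" "Dn s m \<noteq> 0" "y t = param (?x (l t)) s m"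
        using param_surj[of "y t" "?x (l t)"] yx by metis
      then show ?thesis
        using polyfun_vanishing_at_param[OF f rat] \<open>G (?x (l t)) \<noteq> 0\<close> by metis
    qed
    have "(\<lambda>t. y t v) \<midarrow>0\<rightarrow> z v" for v
    proof (cases "v = Y2")
      case True
      then show ?thesis using r(2) by (simp add: y_def)
    next
      case False
      have "(\<lambda>t. z v + t * (g v - z v)) \<midarrow>0\<rightarrow> z v + 0 * (g v - z v)"
        by (intro tendsto_intros)
      then show ?thesis using False by (simp add: y_def l_def)
    qed
    then have "(\<lambda>t. f (y t)) \<midarrow>0\<rightarrow> f z" using polyfun_tendsto[OF f] by blast
    then have "(\<lambda>t :: complex. 0) \<midarrow>0\<rightarrow> f z"
    proof (rule Lim_transform_eventually)
      have "eventually (\<lambda>t. poly ph t \<noteq> 0) (at 0)"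
        using fin islimpt_finite[of _ 0] by (fastforce simp: islimpt_iff_eventually)
      then show "eventually (\<lambda>t. f (y t) = 0) (at 0)"
        by (rule eventually_mono) (use zero ph in auto)
    qed
    then show "f z = 0" using LIM_const_eq by metis
  qed
qed

section \<open>Infinitely many rational curves\<close>

text \<open>The conic bundle relation \<open>w - q^2 = k * s^2 * (1 - p^2)\<close>, multiplied by
  \<open>(E * F x)^2\<close>. It involves \<open>z\<close> and \<open>s^2\<close> only, so it can
  tell curves apart.\<close>

lemma param_relation:
  assumes "s \<noteq> 0" "Dn s m \<noteq> 0" "G x \<noteq> 0" and z: "z = param x s m"
  shows "G (\<lambda>i. z (X i)) - (z Y2)\<^sup>2 = k * s\<^sup>2 * ((F (\<lambda>i. z (X i)))\<^sup>2 - (z Y1)\<^sup>2)"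
proof -
  define E where "E = scale x s m ^ d"
  define w where "w = Wn s m / (s\<^sup>2 * (Dn s m)\<^sup>2)"
  define p where "p = Pn s m / Dn s m"
  define q where "q = Qn s m / (s * Dn s m)"
  have "Wn s m = w * (s\<^sup>2 * (Dn s m)\<^sup>2)" "Pn s m = p * Dn s m" "Qn s m = q * (s * Dn s m)"
    using assms by (simp_all add: w_def p_def q_def)
  then have "s\<^sup>2 * (Dn s m)\<^sup>2 * w = s\<^sup>2 * (Dn s m)\<^sup>2 * (q\<^sup>2 + k * s\<^sup>2 * (1 - p\<^sup>2))"
    unfolding Wn_def cf_def by algebra
  then have w: "w = q\<^sup>2 + k * s\<^sup>2 * (1 - p\<^sup>2)" using assms by simp
  have sc: "scale x s m * G x = (F x)\<^sup>2 * w" using assms by (simp add: scale_def w_def)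
  have "scale x s m ^ (2 * d + 1) * G x = E\<^sup>2 * (scale x s m * G x)"
    by (simp add: E_def power_add mult.commute flip: power_mult)
  then show ?thesis
    unfolding z param_simps F_scale G_scale sc w
    by (simp only: power_mult_distrib flip: E_def p_def q_def) (simp add: algebra_simps)
qed

definition curve :: "('n \<Rightarrow> complex) \<Rightarrow> complex \<Rightarrow> ('n coord \<Rightarrow> complex) set" where
  "curve x s = zariski closure_of {param x s m | m. Dn s m \<noteq> 0}"

lemma param_in_curve: "Dn s m \<noteq> 0 \<Longrightarrow> param x s m \<in> curve x s"
  unfolding curve_def using closure_of_subset[of "{param x s m | m. Dn s m \<noteq> 0}" zariski] by auto

lemma curve_subset_W:
  assumes "s \<noteq> 0" "G x \<noteq> 0"
  shows "curve x s \<subseteq> hypersurface_W a b f1 f2"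
  unfolding curve_def
  by (rule closure_of_minimal) (use assms in \<open>auto intro: param_in_W closedin_W\<close>)

lemma curve_relation:
  assumes "s \<noteq> 0" "G x \<noteq> 0" "z \<in> curve x s"
  shows "G (\<lambda>i. z (X i)) - (z Y2)\<^sup>2 = k * s\<^sup>2 * ((F (\<lambda>i. z (X i)))\<^sup>2 - (z Y1)\<^sup>2)"
proof -
  let ?h = "\<lambda>z. G (\<lambda>i. z (X i)) - (z Y2)\<^sup>2 - k * s\<^sup>2 * ((F (\<lambda>i. z (X i)))\<^sup>2 - (z Y1)\<^sup>2)"
  have "polyfun ?h"
    by (intro polyfun_intros polyfun_F polyfun_G)
  then have "closedin zariski {z. ?h z = 0}" by (rule closedin_zariski_polyfun)
  moreover have "{param x s m | m. Dn s m \<noteq> 0} \<subseteq> {z. ?h z = 0}"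
    using param_relation[OF assms(1) _ assms(2)] by auto
  ultimately have "curve x s \<subseteq> {z. ?h z = 0}"
    unfolding curve_def by (intro closure_of_minimal)
  then show ?thesis using assms(3) by auto
qed

text \<open>At the point of slope -1 the relations for \<open>s\<close> and \<open>s'\<close> both
  hold, and the factor \<open>?R\<close> multiplying \<open>k * s^2\<close> is nonzero.\<close>

lemma curve_inj:
  assumes "F x \<noteq> 0" "G x \<noteq> 0" "s \<noteq> 0" "s' \<noteq> 0" "norm (cf s) > 4" "curve x s = curve x s'"
  shows "s\<^sup>2 = s'\<^sup>2"
proof -
  let ?z = "param x s (-1)"
  let ?R = "(F (\<lambda>i. ?z (X i)))\<^sup>2 - (?z Y1)\<^sup>2"
  define c where "c = cf s"
  \<comment> \<open>The bound 4 keeps \<open>c\<close> away from 1, -25/7 and -3, the values where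
    \<open>Dn\<close>, the scale or \<open>?R\<close> would degenerate.\<close>
  have c: "1 - c \<noteq> 0" "25 + 7 * c \<noteq> 0" "3 + c \<noteq> 0"
  proof -
    have "norm c > 4" using assms(5) by (simp add: c_def)
    then have "norm c \<noteq> norm (1 :: complex)" "norm (7 * c) \<noteq> norm (- 25 :: complex)"
      "norm c \<noteq> norm (- 3 :: complex)"
      by (simp_all add: norm_mult)
    then show "1 - c \<noteq> 0" "25 + 7 * c \<noteq> 0" "3 + c \<noteq> 0"
      by (metis right_minus_eq, metis add_eq_0_iff, metis add_eq_0_iff)
  qed
  have D: "Dn s (-1) = 1 - c" and P: "Pn s (-1) = 7 + c" and Q: "Qn s (-1) = - 5 - 3 * c"
    by (simp_all add: Dn_def Pn_def Qn_def c_def)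
  have "Wn s (-1) = (25 + 7 * c) * (1 - c)"
    unfolding Wn_def D P Q c_def[symmetric] by algebra
  then have sc: "scale x s (-1) \<noteq> 0" using assms c by (simp add: scale_def D)
  have "?z \<in> curve x s" using param_in_curve D c by simp
  then have "k * s\<^sup>2 * ?R = k * s'\<^sup>2 * ?R"
    using curve_relation assms by metis
  moreover have "?R \<noteq> 0"
  proof -
    define r where "r = (7 + c) / (1 - c)"
    have r: "r * (1 - c) = 7 + c" using c by (simp add: r_def)
    have "r\<^sup>2 \<noteq> 1"
    proof
      assume "r\<^sup>2 = 1"
      with r have "16 * (3 + c) = 0" by algebra
      then show False using c(3) by (simp only: mult_eq_0_iff) simp
    qed
    moreover have "?R = (scale x s (-1) ^ d * F x)\<^sup>2 * (1 - r\<^sup>2)"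
      unfolding param_simps F_scale D P r_def[symmetric]
      by (simp only: power_mult_distrib right_diff_distrib mult_1_right)
    ultimately show ?thesis using sc assms(1) by simp
  qed
  ultimately show ?thesis using k_nonzero by simp
qed

text \<open>The horizontal line gives \<open>p = -1\<close>; the tangent at \<open>(1, 1)\<close>,
  of slope \<open>(1 + c) / 2\<close>, gives \<open>p = 1\<close>. Equal images would have equal
  values of \<open>F\<close> but opposite \<open>Y1\<close>, both nonzero.\<close>

lemma param_nonconstant:
  assumes "F x \<noteq> 0" "G x \<noteq> 0" "s \<noteq> 0" "norm (cf s) > 4"
  obtains m m' where "Dn s m \<noteq> 0" "Dn s m' \<noteq> 0" "param x s m \<noteq> param x s m'"
proof -
  define c where "c = cf s"
  have c: "1 + c \<noteq> 0" "c - 1 \<noteq> 0"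
  proof -
    have "c \<noteq> 1" "c \<noteq> - 1" using assms(4) unfolding c_def by auto
    then show "1 + c \<noteq> 0" "c - 1 \<noteq> 0"
      by (auto simp: add_eq_0_iff)
  qed
  define m where "m = (1 + c) / 2"
  have 0: "Dn s 0 = - (1 + c)" "Pn s 0 = 1 + c" "Qn s 0 = - (1 + c)"
    by (simp_all add: Dn_def Pn_def Qn_def c_def)
  have m2: "2 * m = 1 + c" by (simp add: m_def)
  have D: "Dn s m = m * (c - 1)" and P: "Pn s m = Dn s m" and Q: "Qn s m = Dn s m"
    using m2 unfolding Dn_def Pn_def Qn_def c_def by algebra+
  have D0: "Dn s 0 \<noteq> 0" "Dn s m \<noteq> 0" using c 0 D m2 by auto
  have "Wn s 0 = (1 + c)\<^sup>2" "Wn s m = (Dn s m)\<^sup>2"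
    by (simp_all only: Wn_def 0 P Q power2_minus) simp_all
  then have sc: "scale x s 0 \<noteq> 0" "scale x s m \<noteq> 0" using assms D0 c by (simp_all add: scale_def)
  have "param x s 0 \<noteq> param x s m"
  proof
    assume eq: "param x s 0 = param x s m"
    then have "F (\<lambda>i. param x s 0 (X i)) = F (\<lambda>i. param x s m (X i))" by simp
    then have 1: "scale x s 0 ^ d * F x = scale x s m ^ d * F x" by (simp add: F_scale)
    have "Pn s 0 / Dn s 0 = - 1"
      by (simp only: 0 divide_minus_right divide_self[OF c(1)])
    moreover have "Pn s m / Dn s m = 1" using D0 by (simp add: P)
    moreover have "param x s 0 Y1 = param x s m Y1" using eq by simp
    ultimately have "- (scale x s 0 ^ d * F x) = scale x s m ^ d * F x"
      by (simp only: param_simps) simp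
    with 1 show False using sc assms by simp
  qed
  then show ?thesis using that D0 by blast
qed

lemma rational_curve_curve:
  assumes x: "\<And>i. x i \<in> \<rat>" and s: "s \<in> \<rat>"
    and nz: "F x \<noteq> 0" "G x \<noteq> 0" "s \<noteq> 0" "norm (cf s) > 4"
  shows "rational_curve (curve x s)"
proof -
  have "F x \<in> \<rat>" "G x \<in> \<rat>" "cf s \<in> \<rat>"
    using x s by (simp_all add: F_def G_def cf_def k_def mpoly_eval_in_Rats)
  then obtain Fr Gr cr where r: "F x = of_rat Fr" "G x = of_rat Gr" "cf s = of_rat cr"
    by (metis Rats_cases)
  obtain sr where sr: "s = of_rat sr" using s by (metis Rats_cases)
  obtain xr where xr: "\<And>i. x i = of_rat (xr i)"
    using choice[of "\<lambda>i r. x i = of_rat r"] x Rats_cases by metis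
  define e where "e p t = poly (map_poly of_rat p) t" for p :: "rat poly" and t :: complex
  have e_simps: "e (p * q) t = e p t * e q t" "e (p + q) t = e p t + e q t" "e (p - q) t = e p t - e q t"
    "e (smult u p) t = of_rat u * e p t" "e (p ^ n) t = e p t ^ n"
    "e (pCons u p) t = of_rat u + t * e p t" "e 0 t = 0" for p q t u n
    by (simp_all add: e_def poly_map_poly_of_rat)
  define D P Q where "D = [:- (1 + cr), 0, 2:]" and "P = [:1 + cr, -4, 2:]"
    and "Q = [:- (1 + cr), 2 * (1 + cr), -2:]"
  define W where "W = Q\<^sup>2 + smult cr (D\<^sup>2 - P\<^sup>2)"
  have eD: "e D t = Dn s t" and eP: "e P t = Pn s t" and eQ: "e Q t = Qn s t" for t
    by (simp_all add: D_def P_def Q_def e_simps Dn_def Pn_def Qn_def r of_rat_add of_rat_mult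
        of_rat_minus of_rat_diff power2_eq_square algebra_simps)
  have eW: "e W t = Wn s t" for t
    by (simp add: W_def Wn_def e_simps eD eP eQ r)
  define u where "u = Fr\<^sup>2 / (Gr * sr\<^sup>2)"
  have scale: "scale x s t = of_rat u * Wn s t / (Dn s t)\<^sup>2" for t
    by (simp add: scale_def u_def r sr of_rat_mult of_rat_divide of_rat_power)
  define num where "num v = (case v of X i \<Rightarrow> smult (u * xr i) W
     | Y1 \<Rightarrow> smult (u ^ d * Fr) (W ^ d * P) | Y2 \<Rightarrow> smult (u ^ d * Fr / sr) (W ^ d * Q))" for v
  \<comment> \<open>All denominators are powers of \<open>D\<close> with positive exponent, also for
    \<open>d = 0\<close>, so the quotients are defined exactly where
    \<open>Dn s t \<noteq> 0\<close>.\<close>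
  define den where "den v = (case v of X i \<Rightarrow> D\<^sup>2 | _ \<Rightarrow> D ^ (2 * d + 1))" for v :: "'n coord"
  have den_iff: "e (den v) t \<noteq> 0 \<longleftrightarrow> Dn s t \<noteq> 0" for v t
    by (cases v) (auto simp: den_def e_simps eD)
  have param: "param x s t = (\<lambda>v. e (num v) t / e (den v) t)" for t
  proof
    fix v
    have "Dn s t ^ (2 * d + 1) = ((Dn s t)\<^sup>2) ^ d * Dn s t"
      by (simp only: power_add power_mult power_one_right)
    then have den: "e (den Y1) t = ((Dn s t)\<^sup>2) ^ d * Dn s t" "e (den Y2) t = ((Dn s t)\<^sup>2) ^ d * Dn s t"
      by (simp_all only: den_def coord.case e_simps eD)
    have denX: "e (den (X i)) t = (Dn s t)\<^sup>2" for i
      by (simp add: den_def e_simps eD)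
    show "param x s t v = e (num v) t / e (den v) t"
    proof (cases v)
      case (X i)
      then show ?thesis by (simp add: num_def denX e_simps eW scale xr of_rat_mult)
    next
      case Y1
      have "(c * w / y) ^ d * f * (p / z) = c ^ d * f * (w ^ d * p) / (y ^ d * z)"
        for c w y f p z :: complex
        by (simp add: power_mult_distrib power_divide)
      then show ?thesis
        unfolding Y1 param_simps num_def coord.case den e_simps eP eW scale r of_rat_mult of_rat_power .
    next
      case Y2
      have "(c * w / y) ^ d * f * (p / (q * z)) = c ^ d * f / q * (w ^ d * p) / (y ^ d * z)"
        for c w y f p z q :: complex
        by (simp add: power_mult_distrib power_divide ac_simps)
      then show ?thesis
        unfolding Y2 param_simps num_def coord.case den e_simps eQ eW scale r of_rat_mult of_rat_power
          of_rat_divide sr[symmetric] .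
    qed
  qed
  obtain m m' where m: "Dn s m \<noteq> 0" "Dn s m' \<noteq> 0" "param x s m \<noteq> param x s m'"
    using param_nonconstant[OF nz] .
  obtain v where v: "param x s m v \<noteq> param x s m' v" using m by blast
  show ?thesis
    unfolding rational_curve_def
  proof (intro exI conjI)
    have "D \<noteq> 0" by (simp add: D_def)
    then show "\<forall>v. den v \<noteq> 0" by (simp add: den_def split: coord.split)
    have "num v \<noteq> smult c (den v)" for c
    proof
      assume "num v = smult c (den v)"
      then have "param x s t v = of_rat c" if "Dn s t \<noteq> 0" for t
        using den_iff[of v t] that by (simp add: param e_simps)
      then show False using m v by simp
    qed
    then show "\<forall>c. num v \<noteq> smult c (den v)" by blast
    show "curve x s = zariski closure_of
        {(\<lambda>v. poly (map_poly of_rat (num v)) t / poly (map_poly of_rat (den v)) t) | t.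
          \<forall>v. poly (map_poly of_rat (den v)) t \<noteq> 0}"
      unfolding curve_def e_def[symmetric] by (simp add: den_iff param)
  qed
qed

lemma infinite_rational_curves:
  "infinite {C. rational_curve C \<and> C \<subseteq> hypersurface_W a b f1 f2}"
proof -
  obtain x where x: "\<And>i. x i \<in> \<rat>" "F x \<noteq> 0" "G x \<noteq> 0" by (rule exists_rational_FG_nonzero) blast
  \<comment> \<open>The parameter \<open>s\<close> runs through the integers from \<open>N\<close>
    on: \<open>n \<le> n ^ 4\<close> then gives \<open>norm (cf n) > 4\<close>, and distinct
    \<open>n\<close> have distinct squares, as \<open>curve_inj\<close> requires.\<close>
  obtain N :: nat where N: "4 / norm k < real N" using reals_Archimedean2 by blast
  have N0: "N > 0" using N by (cases N) (auto simp: divide_less_0_iff not_less)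
  have big: "norm (cf (of_nat n)) > 4" if "n \<ge> N" for n
  proof -
    have "n \<ge> 1" using N0 that by linarith
    then have "real n \<le> real n ^ 4" using power_increasing[of 1 4 "real n"] by simp
    moreover have "real N \<le> real n" using that by simp
    ultimately have "4 / norm k < real n ^ 4" using N by linarith
    then have "4 < real n ^ 4 * norm k" using k_nonzero by (simp add: pos_divide_less_eq)
    then show ?thesis by (simp add: cf_def norm_mult norm_power mult.commute)
  qed
  have "inj_on (\<lambda>n. curve x (of_nat n)) {N..}"
  proof (rule inj_onI)
    fix i j :: nat assume ij: "i \<in> {N..}" "j \<in> {N..}" "curve x (of_nat i) = curve x (of_nat j)"
    then have "(of_nat i :: complex)\<^sup>2 = (of_nat j)\<^sup>2"
      using N0 big x by (intro curve_inj[of x]) auto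
    then have "i\<^sup>2 = j\<^sup>2" by (metis of_nat_eq_iff of_nat_power)
    then show "i = j" by simp
  qed
  then have "infinite ((\<lambda>n. curve x (of_nat n)) ` {N..})"
    by (simp add: finite_image_iff infinite_Ici)
  moreover have "(\<lambda>n. curve x (of_nat n)) ` {N..}
      \<subseteq> {C. rational_curve C \<and> C \<subseteq> hypersurface_W a b f1 f2}"
  proof (intro image_subsetI CollectI conjI)
    fix n assume "n \<in> {N..}"
    then have n: "n \<ge> N" "(of_nat n :: complex) \<noteq> 0" using N0 by auto
    show "rational_curve (curve x (of_nat n))"
      by (rule rational_curve_curve[OF x(1) _ x(2,3) n(2) big[OF n(1)]]) simp
    show "curve x (of_nat n) \<subseteq> hypersurface_W a b f1 f2"
      by (rule curve_subset_W[OF n(2) x(3)])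
  qed
  ultimately show ?thesis by (rule infinite_super[rotated])
qed

end

theorem theorem6p3:
  fixes a b :: int and f1 f2 :: "('n::finite, int) mpoly"
  assumes "a \<noteq> 0" and "b \<noteq> 0"
    and "f1 \<noteq> 0" and "homogeneous f1"
    and "f2 \<noteq> 0" and "homogeneous f2"
    and "total_degree f2 = 2 * total_degree f1 + 1"
  shows "zariski closure_of rational_points (hypersurface_W a b f1 f2) = hypersurface_W a b f1 f2
    \<and> infinite {C. rational_curve C \<and> C \<subseteq> hypersurface_W a b f1 f2}"
proof -
  interpret quartic_hypersurface a b f1 f2 by unfold_locales (use assms in auto)
  have "zariski closure_of rational_points (hypersurface_W a b f1 f2) \<subseteq> hypersurface_W a b f1 f2"
    by (rule closure_of_minimal) (auto simp: rational_points_def closedin_W)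
  then show ?thesis using rational_points_dense infinite_rational_curves by blast
qed

end
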